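(* The lengths $L(\Gamma_n)=\int_{-\pi}^{\pi}|\Gamma_n'(t)|\,dt=\int_{-\pi}^{\pi}|F_n'(t)|\,dt$ are not uniformly bounded as $n\to\infty$. In fact, $L(\Gamma_n)\to\infty$ as $n\to\infty$.
   Context: For $n\in\mathbb{N}$ and a prime $p$, $v_p(n!)$ denotes the exponent of $p$ in the prime factorization of $n!$. For each $n\in\mathbb{N}$ define $F_n(t)=\sum_{p\le n} v_p(n!)\,e^{ipt}$ for $t\in[-\pi,\pi]$, where the sum runs over primes $p\le n$. The associated planar curve is $\Gamma_n(t)=(\operatorname{Re}F_n(t),\operatorname{Im}F_n(t))\in\mathbb{R}^2$, $t\in[-\pi,\pi]$. *)

theory Defs
  imports "HOL-Analysis.Analysis" "HOL-Computational_Algebra.Primes"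
begin

definition fact_exp_sum :: "nat \<Rightarrow> real \<Rightarrow> complex" where
  "fact_exp_sum n t =
     (\<Sum>p | prime p \<and> p \<le> n.
        of_nat (multiplicity p (fact n :: nat)) * exp (\<i> * of_nat p * of_real t))"

definition fact_curve :: "nat \<Rightarrow> real \<Rightarrow> real \<times> real" where
  "fact_curve n t = (Re (fact_exp_sum n t), Im (fact_exp_sum n t))"

text \<open>The norm on \<^typ>\<open>real \<times> real\<close> is the Euclidean one. Derivatives are taken within
  the parameter interval, so they are one-sided at its endpoints.\<close>

definition curve_length :: "real \<Rightarrow> real \<Rightarrow> (real \<Rightarrow> 'a::real_normed_vector) \<Rightarrow> real" where
  "curve_length a b \<gamma> =
     integral {a..b} (\<lambda>t. norm (vector_derivative \<gamma> (at t within {a..b})))"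

end

theory Submission
  imports Defs
begin

text \<open>Integrating \<open>F\<^sub>n'(t) e\<^sup>-\<^sup>2\<^sup>i\<^sup>t\<close> over a period isolates the Fourier coefficient at the prime 2, so the
  length is at least \<open>2\<pi> \<sqdot> 2 v\<^sub>2(n!)\<close>, and \<open>v\<^sub>2(n!) \<ge> \<lfloor>n/2\<rfloor>\<close>.\<close>

text \<open>An explicit termwise formula, from which continuity and the Fourier coefficient can be
  read off.\<close>

definition fact_exp_sum_deriv :: "nat \<Rightarrow> real \<Rightarrow> complex" where
  "fact_exp_sum_deriv n t =
     (\<Sum>p | prime p \<and> p \<le> n.
        of_nat (multiplicity p (fact n :: nat)) * (\<i> * of_nat p * exp (\<i> * of_nat p * of_real t)))"

lemma has_vector_derivative_exp_mult_of_real: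
  fixes c :: complex
  shows "((\<lambda>t. exp (c * of_real t)) has_vector_derivative c * exp (c * of_real t)) (at t within S)"
proof -
  have "((\<lambda>z. exp (c * z)) has_field_derivative c * exp (c * of_real t)) (at (of_real t))"
    by (auto intro!: derivative_eq_intros)
  then show ?thesis
    by (rule has_vector_derivative_real_field)
qed

lemma has_vector_derivative_fact_exp_sum:
  "(fact_exp_sum n has_vector_derivative fact_exp_sum_deriv n t) (at t within S)"
  unfolding fact_exp_sum_def[abs_def] fact_exp_sum_deriv_def
  by (intro has_vector_derivative_sum has_vector_derivative_mult_right
        has_vector_derivative_exp_mult_of_real)

lemma has_vector_derivative_fact_curve:
  "(fact_curve n has_vector_derivative
      (Re (fact_exp_sum_deriv n t), Im (fact_exp_sum_deriv n t))) (at t within S)"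
  unfolding fact_curve_def[abs_def]
  by (intro has_vector_derivative_Pair has_vector_derivative_fact_exp_sum
        bounded_linear.has_vector_derivative[OF bounded_linear_Re]
        bounded_linear.has_vector_derivative[OF bounded_linear_Im])

lemma continuous_on_fact_exp_sum_deriv: "continuous_on S (fact_exp_sum_deriv n)"
  unfolding fact_exp_sum_deriv_def[abs_def] by (intro continuous_intros)

text \<open>Since \<open>-pi < pi\<close>, derivatives within the interval are unique even at its
  endpoints, so \<open>vector_derivative\<close> agrees with the explicit formula
  everywhere.\<close>

lemma integral_norm_deriv_fact_exp_sum:
  "integral {-pi..pi} (\<lambda>t. cmod (vector_derivative (fact_exp_sum n) (at t within {-pi..pi})))
     = integral {-pi..pi} (\<lambda>t. cmod (fact_exp_sum_deriv n t))"
  by (intro integral_cong)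
     (simp add: vector_derivative_within_closed_interval[OF _ _ has_vector_derivative_fact_exp_sum])

lemma curve_length_fact_curve:
  "curve_length (-pi) pi (fact_curve n) = integral {-pi..pi} (\<lambda>t. cmod (fact_exp_sum_deriv n t))"
  unfolding curve_length_def
  by (intro integral_cong)
     (simp add: vector_derivative_within_closed_interval[OF _ _ has_vector_derivative_fact_curve]
        norm_Pair cmod_def)

text \<open>Orthogonality of characters: for \<open>m \<noteq> 0\<close> the antiderivative
  \<open>exp (\<i> * m * t) / (\<i> * m)\<close> takes equal values at both endpoints.\<close>

lemma has_integral_exp_int_period:
  fixes m :: int
  shows "((\<lambda>t. exp (\<i> * of_int m * of_real t)) has_integral (if m = 0 then 2 * of_real pi else 0))
           {-pi..pi}"
proof (cases "m = 0")
  case True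
  then show ?thesis
    using has_integral_const_real[of "1::complex" "-pi" pi] by (simp add: scaleR_conv_of_real)
next
  case False
  let ?c = "\<i> * of_int m"
  have "((\<lambda>t. exp (?c * of_real t)) has_integral
      exp (?c * of_real pi) / ?c - exp (?c * of_real (-pi)) / ?c) {-pi..pi}"
  proof (rule fundamental_theorem_of_calculus)
    fix t :: real
    show "((\<lambda>t. exp (?c * of_real t) / ?c) has_vector_derivative exp (?c * of_real t))
            (at t within {-pi..pi})"
      using has_vector_derivative_divide
          [OF has_vector_derivative_exp_mult_of_real, where a = ?c and c1 = ?c]
        False by simp
  qed simp
  \<comment> \<open>The exponents differ by \<open>2 * pi * \<i> * m\<close>, that is, by
    \<open>m\<close> periods of \<open>exp\<close>.\<close>
  moreover have "exp (?c * of_real pi) = exp (?c * of_real (-pi))"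
    unfolding exp_eq by (intro exI[of _ m]) (simp add: algebra_simps)
  ultimately show ?thesis
    using False by simp
qed

lemma has_integral_fact_exp_sum_deriv_coeff_2:
  assumes "n \<ge> 2"
  shows "((\<lambda>t. fact_exp_sum_deriv n t * exp (- (2 * \<i> * of_real t))) has_integral
           4 * of_real pi * \<i> * of_nat (multiplicity 2 (fact n :: nat))) {-pi..pi}"
proof -
  define P where "P = {p. prime p \<and> p \<le> n}"
  define v where "v p = multiplicity p (fact n :: nat)" for p
  \<comment> \<open>The twist shifts frequency \<open>p\<close> to \<open>p - 2\<close>; it is taken
    in the integers to match \<open>has_integral_exp_int_period\<close>.\<close>
  let ?e = "\<lambda>p t. exp (\<i> * of_int (int p - 2) * of_real t) :: complex"
  let ?I = "\<lambda>p. if int p - 2 = 0 then 2 * of_real pi else 0 :: complex"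
  have "finite P" "2 \<in> P"
    using assms by (auto simp: P_def intro: two_is_prime_nat)
  have "((\<lambda>t. \<Sum>p\<in>P. (of_nat (v p) * \<i> * of_nat p) * ?e p t) has_integral
          (\<Sum>p\<in>P. (of_nat (v p) * \<i> * of_nat p) * ?I p)) {-pi..pi}"
    by (intro has_integral_sum has_integral_mult_right has_integral_exp_int_period \<open>finite P\<close>)
  moreover have "(\<Sum>p\<in>P. (of_nat (v p) * \<i> * of_nat p) * ?e p t) =
      fact_exp_sum_deriv n t * exp (- (2 * \<i> * of_real t))" for t
    unfolding fact_exp_sum_deriv_def P_def v_def sum_distrib_right
    by (intro sum.cong refl) (simp add: algebra_simps flip: exp_add)
  \<comment> \<open>Only frequency zero survives: \<open>p = 2\<close> contributes
    \<open>2 * \<i> * v 2\<close> times the period \<open>2 * pi\<close>.\<close>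
  moreover have "(\<Sum>p\<in>P. (of_nat (v p) * \<i> * of_nat p) * ?I p) =
      (\<Sum>p\<in>P. if p = 2 then 4 * of_real pi * \<i> * of_nat (v 2) else 0)"
    by (intro sum.cong) auto
  ultimately show ?thesis
    using \<open>finite P\<close> \<open>2 \<in> P\<close> by (simp add: v_def)
qed

text \<open>The twist \<open>exp (- (2 * \<i> * t))\<close> has modulus 1, so the modulus of the
  Fourier coefficient is at most the integral of the speed.\<close>

lemma curve_length_fact_curve_ge:
  assumes "n \<ge> 2"
  shows "4 * pi * multiplicity 2 (fact n :: nat) \<le> curve_length (-pi) pi (fact_curve n)"
proof -
  let ?f = "\<lambda>t. fact_exp_sum_deriv n t * exp (- (2 * \<i> * of_real t))"
  note I = has_integral_fact_exp_sum_deriv_coeff_2[OF assms]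
  have "norm (integral {-pi..pi} ?f) \<le> integral {-pi..pi} (\<lambda>t. cmod (fact_exp_sum_deriv n t))"
  proof (rule integral_norm_bound_integral)
    show "?f integrable_on {-pi..pi}"
      using I by blast
    show "(\<lambda>t. cmod (fact_exp_sum_deriv n t)) integrable_on {-pi..pi}"
      by (intro integrable_continuous_real continuous_on_norm continuous_on_fact_exp_sum_deriv)
  qed (simp add: norm_mult)
  then show ?thesis
    by (simp add: integral_unique[OF I] curve_length_fact_curve norm_mult)
qed

text \<open>Passing from \<open>2 * k\<close> to \<open>2 * k + 2\<close> multiplies the factorial
  by \<open>(2 * k + 1) * (2 * k + 2)\<close>, which supplies one more factor 2.\<close>

lemma two_power_dvd_fact_double: "2 ^ k dvd (fact (2 * k) :: nat)"
proof (induction k)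
  case (Suc k)
  have "(fact (2 * Suc k) :: nat) = 2 * ((Suc k * Suc (2 * k)) * fact (2 * k))"
    by (simp add: algebra_simps)
  with Suc show ?case
    by (simp del: fact_Suc)
qed simp

lemma multiplicity_2_fact_ge: "n div 2 \<le> multiplicity 2 (fact n :: nat)"
proof (rule multiplicity_geI)
  show "2 ^ (n div 2) dvd (fact n :: nat)"
    \<comment> \<open>Odd \<open>n\<close> is covered too: \<open>2 * (n div 2) \<le> n\<close>, so
      the smaller factorial divides \<open>fact n\<close>.\<close>
    using two_power_dvd_fact_double[of "n div 2"] by (rule dvd_trans) (simp add: fact_dvd)
qed simp_all

lemma curve_length_fact_curve_at_top:
  "filterlim (\<lambda>n. curve_length (-pi) pi (fact_curve n)) at_top sequentially"
proof (rule filterlim_at_top_mono)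
  show "filterlim (\<lambda>n. real (n div 2)) at_top sequentially"
    by (intro filterlim_compose[OF filterlim_real_sequentially] filterlim_at_top_div_const_nat) simp
  show "\<forall>\<^sub>F n in sequentially. real (n div 2) \<le> curve_length (-pi) pi (fact_curve n)"
    using eventually_ge_at_top[of 2]
  proof eventually_elim
    case (elim n)
    have "real (n div 2) \<le> 1 * real (multiplicity 2 (fact n :: nat))"
      using multiplicity_2_fact_ge[of n] by simp
    \<comment> \<open>Divergence needs no sharp constant, so \<open>4 * pi\<close> is only compared
      with 1.\<close>
    also have "\<dots> \<le> 4 * pi * multiplicity 2 (fact n :: nat)"
      using pi_gt3 by (intro mult_right_mono) auto
    finally show ?case
      using curve_length_fact_curve_ge[OF elim] by linarith
  qed
qed

theorem theorem4p3:
  shows "(\<forall>n. curve_length (-pi) pi (fact_curve n) =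
            integral {-pi..pi}
              (\<lambda>t. cmod (vector_derivative (fact_exp_sum n) (at t within {-pi..pi}))))
       \<and> \<not> (\<exists>B::real. \<forall>n. curve_length (-pi) pi (fact_curve n) \<le> B)
       \<and> filterlim (\<lambda>n. curve_length (-pi) pi (fact_curve n)) at_top sequentially"
proof (intro conjI)
  show "\<not> (\<exists>B::real. \<forall>n. curve_length (-pi) pi (fact_curve n) \<le> B)"
  proof
    assume "\<exists>B::real. \<forall>n. curve_length (-pi) pi (fact_curve n) \<le> B"
    then obtain B where "\<And>n. curve_length (-pi) pi (fact_curve n) \<le> B"
      by blast
    \<comment> \<open>Divergence makes the lengths exceed \<open>B\<close> eventually, and an
      eventual property holds somewhere because \<open>sequentially\<close> is a proper
      filter.\<close>
    moreover obtain n where "curve_length (-pi) pi (fact_curve n) > B"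
      using curve_length_fact_curve_at_top
      unfolding filterlim_at_top_dense by (metis eventually_happens' sequentially_bot)
    ultimately show False
      by (simp add: not_le[symmetric])
  qed
qed (use curve_length_fact_curve_at_top in
      \<open>simp_all add: curve_length_fact_curve integral_norm_deriv_fact_exp_sum\<close>)

end
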